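(* Let $\mathbb{F}$ be a field of characteristic $0$, let $Z=\{P_1,\dots,P_r\}$ be a set of $r$ distinct points in $\mathbb{P}^n$ over $\mathbb{F}$, and let $d,m$ be positive integers with $\binom{d+n}{n}=\binom{m+n-1}{n}+r+1$. Let $F(a_0,\dots,a_n,x_0,\dots,x_n)=\det M$, where $M$ is the interpolation matrix of $(Z,d,m)$. Fix a point $S=(y_0,\dots,y_n)\in\mathbb{P}^n$ and assume that $F(a_0,\dots,a_n,S)\not\equiv 0$ (as a polynomial in $a_0,\dots,a_n$). Then $F(a_0,\dots,a_n,S)=0$ defines a hypersurface in $\mathbb{P}^n$ (with coordinates $a_0,\dots,a_n$) of degree $\binom{m+n-1}{n}(d-m+1)$ which vanishes with multiplicity at least $m$ at $S$ and at each of the points $P_1,\dots,P_r$.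
   Context: Interpolation matrix. Fix coordinates $(p_{i0},\dots,p_{in})$ of each $P_i$. Let $w=w(a_0,\dots,a_n)$ be the row vector of all $\binom{d+n}{n}$ monomials of degree $d$ in $a_0,\dots,a_n$, in some fixed order. For a tuple $Q=(q_0,\dots,q_n)$, $w(Q)$ denotes $w$ with $q_i$ substituted for $a_i$. The interpolation matrix $M$ is the square matrix of size $\binom{d+n}{n}$ with entries in $\mathbb{F}[a_0,\dots,a_n,x_0,\dots,x_n]$ whose rows are, in order: the $\binom{m+n-1}{n}$ rows $\frac{\partial^{m-1}}{\partial a_0^{t_0}\cdots\partial a_n^{t_n}}w$ for all $(t_0,\dots,t_n)\in\mathbb{Z}_{\ge0}^{n+1}$ with $t_0+\cdots+t_n=m-1$ (derivatives taken entrywise, in some fixed order); then the $r$ rows $w(P_1),\dots,w(P_r)$; and finally the row $w(x_0,\dots,x_n)$. $F(a_0,\dots,a_n,S)$ denotes $F$ with the coordinates $y_i$ of $S$ substituted for $x_i$. *)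

theory Defs
  imports "HOL-Library.Poly_Mapping" "Jordan_Normal_Form.Determinant"
begin

type_synonym ('v, 'a) mpoly = "('v \<Rightarrow>\<^sub>0 nat) \<Rightarrow>\<^sub>0 'a"

definition Const :: "'a::zero \<Rightarrow> ('v, 'a) mpoly" where
  "Const c = Poly_Mapping.single 0 c"

definition Var :: "'v \<Rightarrow> ('v, 'a::zero_neq_one) mpoly" where
  "Var v = Poly_Mapping.single (Poly_Mapping.single v 1) 1"

definition mdeg :: "('v \<Rightarrow>\<^sub>0 nat) \<Rightarrow> nat" where
  "mdeg e = (\<Sum>v\<in>Poly_Mapping.keys e. Poly_Mapping.lookup e v)"

definition subst :: "('v \<Rightarrow> ('w, 'a) mpoly) \<Rightarrow> ('v, 'a) mpoly \<Rightarrow> ('w, 'a::comm_ring_1) mpoly" where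
  "subst \<sigma> f = (\<Sum>e\<in>Poly_Mapping.keys f. Const (Poly_Mapping.lookup f e) *
     (\<Prod>v\<in>Poly_Mapping.keys e. \<sigma> v ^ Poly_Mapping.lookup e v))"

text \<open>If \<open>v\<close> does not occur in \<open>e\<close>, the subtraction truncates, but the coefficient is then \<open>0\<close>.\<close>

definition pderivative :: "'v \<Rightarrow> ('v, 'a) mpoly \<Rightarrow> ('v, 'a::comm_ring_1) mpoly" where
  "pderivative v f = (\<Sum>e\<in>Poly_Mapping.keys f.
     Poly_Mapping.single (e - Poly_Mapping.single v 1)
       (of_nat (Poly_Mapping.lookup e v) * Poly_Mapping.lookup f e))"

definition exponents :: "nat \<Rightarrow> nat \<Rightarrow> (nat \<Rightarrow>\<^sub>0 nat) set" where
  "exponents n k = {e. Poly_Mapping.keys e \<subseteq> {0..n} \<and> mdeg e = k}"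

text \<open>A point of projective space is the class of its homogeneous coordinate vectors.\<close>

definition proj_space :: "nat \<Rightarrow> 'a::field vec set set" where
  "proj_space n =
     (let U = carrier_vec (n + 1) - {0\<^sub>v (n + 1)}
      in U // {(u, v). u \<in> U \<and> v \<in> U \<and> (\<exists>c. c \<noteq> 0 \<and> v = c \<cdot>\<^sub>v u)})"

datatype ivar = A nat | X nat

definition monomial_row ::
  "nat \<Rightarrow> (nat \<Rightarrow>\<^sub>0 nat) list \<Rightarrow> (nat \<Rightarrow> 'b::comm_ring_1) \<Rightarrow> 'b vec" where
  "monomial_row n es q =
     vec_of_list (map (\<lambda>e. \<Prod>i=0..n. q i ^ Poly_Mapping.lookup e i) es)"

definition a_derivative ::
  "nat \<Rightarrow> (nat \<Rightarrow>\<^sub>0 nat) \<Rightarrow> (ivar, 'a) mpoly \<Rightarrow> (ivar, 'a::comm_ring_1) mpoly" where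
  "a_derivative n t = fold (\<lambda>i. pderivative (A i) ^^ Poly_Mapping.lookup t i) [0..<n + 1]"

text \<open>The list \<open>es\<close> orders the monomials (columns), \<open>ts\<close> orders the derivatives, and
  \<open>ps\<close> lists the chosen coordinates of the points.\<close>

definition interpolation_matrix ::
  "nat \<Rightarrow> (nat \<Rightarrow>\<^sub>0 nat) list \<Rightarrow> (nat \<Rightarrow>\<^sub>0 nat) list \<Rightarrow> 'a::field vec list \<Rightarrow> (ivar, 'a) mpoly mat" where
  "interpolation_matrix n es ts ps = mat_of_rows (length es)
     (map (\<lambda>t. map_vec (a_derivative n t) (monomial_row n es (\<lambda>i. Var (A i)))) ts
      @ map (\<lambda>p. monomial_row n es (\<lambda>i. Const (p $ i))) ps
      @ [monomial_row n es (\<lambda>i. Var (X i))])"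

definition at_x :: "'a vec \<Rightarrow> (ivar, 'a) mpoly \<Rightarrow> (nat, 'a::field) mpoly" where
  "at_x y = subst (\<lambda>v. case v of A i \<Rightarrow> Var i | X i \<Rightarrow> Const (y $ i))"

text \<open>Hypersurfaces are taken with their scheme structure, since the zero set over a field that
  is not algebraically closed does not determine a degree.\<close>

definition defines_hypersurface :: "nat \<Rightarrow> nat \<Rightarrow> (nat, 'a::field) mpoly \<Rightarrow> bool" where
  "defines_hypersurface n k f \<longleftrightarrow> f \<noteq> 0 \<and> k > 0 \<and> Poly_Mapping.keys f \<subseteq> exponents n k"

text \<open>The equation of \<open>f = 0\<close> in the affine chart where coordinate \<open>i\<close> equals \<open>1\<close>, translated so
  that the point with homogeneous coordinates \<open>p\<close> becomes the origin.\<close>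

definition local_equation :: "nat \<Rightarrow> 'a vec \<Rightarrow> (nat, 'a) mpoly \<Rightarrow> (nat, 'a::field) mpoly" where
  "local_equation i p f =
     subst (\<lambda>j. if j = i then 1 else Var j + Const (p $ j / p $ i)) f"

definition vanishes_with_multiplicity ::
  "nat \<Rightarrow> nat \<Rightarrow> (nat, 'a::field) mpoly \<Rightarrow> 'a vec set \<Rightarrow> bool" where
  "vanishes_with_multiplicity n m f P \<longleftrightarrow>
     (\<forall>p\<in>P. \<forall>i\<le>n. p $ i \<noteq> 0 \<longrightarrow>
        (\<forall>e\<in>Poly_Mapping.keys (local_equation i p f). m \<le> mdeg e))"

end

(* Degree: after substituting S, the derivative rows are homogeneous of degree d - m + 1 in a and
   the other rows are constant.

   Multiplicity at p: expand the determinant along the row w(p). The cofactors C_e satisfy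
   sum_e C_e D_s(a^e) = 0 for every divided derivative D_s of order m - 1, because the corresponding
   row occurs elsewhere in the matrix. By Euler's identity, applied downwards, the same holds for
   every order below m (here m <= d and characteristic 0 are used). Taylor's formula for
   w(p) = w(a + (p - a)) then leaves only terms of order at least m in p - a. *)

theory Submission
  imports Defs
begin

section \<open>Substitution as a ring homomorphism\<close>

lemma sum_keys_superset:
  assumes "finite K" "Poly_Mapping.keys f \<subseteq> K" "\<And>e. h e 0 = 0"
  shows "(\<Sum>e\<in>Poly_Mapping.keys f. h e (Poly_Mapping.lookup f e)) = (\<Sum>e\<in>K. h e (Poly_Mapping.lookup f e))"
  using assms by (intro sum.mono_neutral_left) (auto simp: in_keys_iff)

lemma mpoly_eq_sum_single:
  fixes f :: "('v, 'a::comm_ring_1) mpoly"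
  shows "f = (\<Sum>e\<in>Poly_Mapping.keys f. Poly_Mapping.single e (Poly_Mapping.lookup f e))"
proof (rule poly_mapping_eqI)
  fix k
  show "Poly_Mapping.lookup f k =
    Poly_Mapping.lookup (\<Sum>e\<in>Poly_Mapping.keys f. Poly_Mapping.single e (Poly_Mapping.lookup f e)) k"
    by (auto simp: lookup_sum lookup_single when_def in_keys_iff)
qed

interpretation Const: comm_ring_hom "Const :: 'a::comm_ring_1 \<Rightarrow> ('v, 'a) mpoly"
  by unfold_locales (simp_all add: Const_def single_add mult_single)

text \<open>The product inside \<open>subst\<close>, with values in an arbitrary ring, so that its
  behaviour under addition of exponents can be stated on its own.\<close>

definition monomial_at :: "('v \<Rightarrow> 'b::comm_ring_1) \<Rightarrow> ('v \<Rightarrow>\<^sub>0 nat) \<Rightarrow> 'b" where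
  "monomial_at \<sigma> e = (\<Prod>v\<in>Poly_Mapping.keys e. \<sigma> v ^ Poly_Mapping.lookup e v)"

lemma monomial_at_superset:
  assumes "finite K" "Poly_Mapping.keys e \<subseteq> K"
  shows "monomial_at \<sigma> e = (\<Prod>v\<in>K. \<sigma> v ^ Poly_Mapping.lookup e v)"
  unfolding monomial_at_def using assms
  by (intro prod.mono_neutral_left) (auto simp: in_keys_iff)

lemma monomial_at_0 [simp]: "monomial_at \<sigma> 0 = 1"
  by (simp add: monomial_at_def)

lemma monomial_at_add: "monomial_at \<sigma> (e + e') = monomial_at \<sigma> e * monomial_at \<sigma> e'"
proof -
  let ?K = "Poly_Mapping.keys e \<union> Poly_Mapping.keys e'"
  have "monomial_at \<sigma> (e + e') = (\<Prod>v\<in>?K. \<sigma> v ^ Poly_Mapping.lookup (e + e') v)"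
    by (rule monomial_at_superset[OF _ keys_add]) simp
  also have "\<dots> = (\<Prod>v\<in>?K. \<sigma> v ^ Poly_Mapping.lookup e v) * (\<Prod>v\<in>?K. \<sigma> v ^ Poly_Mapping.lookup e' v)"
    by (simp add: lookup_add power_add prod.distrib)
  also have "\<dots> = monomial_at \<sigma> e * monomial_at \<sigma> e'"
    by (simp add: monomial_at_superset[of ?K])
  finally show ?thesis .
qed

text \<open>Cancellation can make the support of a sum smaller than the union of the supports;
  summing over any finite superset puts both polynomials on one index set.\<close>

lemma subst_superset:
  assumes "finite K" "Poly_Mapping.keys f \<subseteq> K"
  shows "subst \<sigma> f = (\<Sum>e\<in>K. Const (Poly_Mapping.lookup f e) * monomial_at \<sigma> e)"
  unfolding subst_def monomial_at_def[symmetric]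
  by (rule sum_keys_superset[OF assms, where h = "\<lambda>e c. Const c * monomial_at \<sigma> e"]) simp

lemma subst_single: "subst \<sigma> (Poly_Mapping.single e c) = Const c * monomial_at \<sigma> e"
  by (subst subst_superset[of "{e}"]) auto

lemma subst_add: "subst \<sigma> (f + g) = subst \<sigma> f + subst \<sigma> g"
proof -
  let ?K = "Poly_Mapping.keys f \<union> Poly_Mapping.keys g"
  have "subst \<sigma> (f + g) = (\<Sum>e\<in>?K. Const (Poly_Mapping.lookup (f + g) e) * monomial_at \<sigma> e)"
    by (rule subst_superset[OF _ keys_add]) simp
  also have "\<dots> = subst \<sigma> f + subst \<sigma> g"
    by (simp add: subst_superset[of ?K] lookup_add Const.hom_add distrib_right sum.distrib)
  finally show ?thesis .
qed

lemma subst_sum: "subst \<sigma> (sum f I) = (\<Sum>i\<in>I. subst \<sigma> (f i))"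
proof (cases "finite I")
  case True
  have "subst \<sigma> 0 = 0" by (simp add: subst_def)
  with True show ?thesis by (induction I) (auto simp: subst_add)
qed (simp add: subst_def)

lemma subst_mult: "subst \<sigma> (f * g) = subst \<sigma> f * subst \<sigma> g"
proof -
  let ?s = "\<lambda>f e. Poly_Mapping.single e (Poly_Mapping.lookup f e)"
  have "subst \<sigma> (f * g) = subst \<sigma> ((\<Sum>e\<in>Poly_Mapping.keys f. ?s f e) * (\<Sum>e\<in>Poly_Mapping.keys g. ?s g e))"
    by (simp flip: mpoly_eq_sum_single)
  also have "\<dots> = (\<Sum>e\<in>Poly_Mapping.keys f. \<Sum>e'\<in>Poly_Mapping.keys g. subst \<sigma> (?s f e) * subst \<sigma> (?s g e'))"
    by (simp add: sum_product subst_sum mult_single subst_single Const.hom_mult monomial_at_add ac_simps)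
  also have "\<dots> = subst \<sigma> (\<Sum>e\<in>Poly_Mapping.keys f. ?s f e) * subst \<sigma> (\<Sum>e\<in>Poly_Mapping.keys g. ?s g e)"
    by (simp add: subst_sum sum_product)
  finally show ?thesis by (simp flip: mpoly_eq_sum_single)
qed

lemma subst_Const [simp]: "subst \<sigma> (Const c) = Const c"
  by (simp add: Const_def[of c] subst_single)

lemma subst_Var [simp]: "subst \<sigma> (Var v) = \<sigma> v"
  by (simp add: Var_def subst_single monomial_at_def)

text \<open>Ring homomorphisms commute with determinants. This serves both the substitution of
  \<open>y\<close> for the \<open>X\<close> variables and the translation to an affine
  chart.\<close>

lemma subst_hom: "comm_ring_hom (subst \<sigma>)"
proof
  show "subst \<sigma> 1 = 1" using subst_Const[of \<sigma> 1] by simp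
  show "subst \<sigma> 0 = 0" by (simp add: subst_def)
qed (simp_all add: subst_add subst_mult)

section \<open>Orders of vanishing and homogeneous polynomials\<close>

text \<open>The powers of the ideal generated by all the variables.\<close>

definition power_ideal :: "nat \<Rightarrow> ('v, 'a::comm_ring_1) mpoly set" where
  "power_ideal k = {f. \<forall>e\<in>Poly_Mapping.keys f. k \<le> mdeg e}"

text \<open>Stated through the support, so 0 is homogeneous of every degree; vanishing matrix
  entries therefore need no exception.\<close>

definition homogeneous :: "nat \<Rightarrow> nat \<Rightarrow> (nat, 'a::comm_ring_1) mpoly set" where
  "homogeneous n k = {f. Poly_Mapping.keys f \<subseteq> exponents n k}"

lemma mdeg_superset:
  assumes "finite K" "Poly_Mapping.keys e \<subseteq> K"
  shows "mdeg e = (\<Sum>v\<in>K. Poly_Mapping.lookup e v)"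
  unfolding mdeg_def using assms
  by (intro sum.mono_neutral_left) (auto simp: in_keys_iff)

lemma mdeg_add: "mdeg (e + e') = mdeg e + mdeg e'"
proof -
  let ?K = "Poly_Mapping.keys e \<union> Poly_Mapping.keys e'"
  have "mdeg (e + e') = (\<Sum>v\<in>?K. Poly_Mapping.lookup (e + e') v)"
    by (rule mdeg_superset[OF _ keys_add]) simp
  also have "\<dots> = mdeg e + mdeg e'"
    by (simp add: mdeg_superset[of ?K] lookup_add sum.distrib)
  finally show ?thesis .
qed

lemma power_ideal_zero: "0 \<in> power_ideal k"
  by (simp add: power_ideal_def)

lemma power_ideal_0 [simp]: "f \<in> power_ideal 0"
  by (simp add: power_ideal_def)

lemma power_ideal_mono: "f \<in> power_ideal k \<Longrightarrow> l \<le> k \<Longrightarrow> f \<in> power_ideal l"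
  by (force simp: power_ideal_def)

lemma power_ideal_add: "f \<in> power_ideal k \<Longrightarrow> g \<in> power_ideal k \<Longrightarrow> f + g \<in> power_ideal k"
  using keys_add[of f g] by (auto simp: power_ideal_def)

lemma power_ideal_sum: "(\<And>i. i \<in> I \<Longrightarrow> f i \<in> power_ideal k) \<Longrightarrow> sum f I \<in> power_ideal k"
  by (induction I rule: infinite_finite_induct) (auto intro: power_ideal_zero power_ideal_add)

lemma power_ideal_mult: "f \<in> power_ideal k \<Longrightarrow> g \<in> power_ideal l \<Longrightarrow> f * g \<in> power_ideal (k + l)"
  using keys_mult[of f g] by (fastforce simp: power_ideal_def mdeg_add intro: add_mono)

lemma power_ideal_mult_left: "g \<in> power_ideal k \<Longrightarrow> f * g \<in> power_ideal k"
  using power_ideal_mult[of f 0 g k] by simp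

lemma power_ideal_power: "f \<in> power_ideal 1 \<Longrightarrow> f ^ k \<in> power_ideal k"
  by (induction k) (use power_ideal_mult in force)+

lemma power_ideal_prod_power:
  "finite I \<Longrightarrow> (\<And>i. i \<in> I \<Longrightarrow> c i \<in> power_ideal 1) \<Longrightarrow> (\<Prod>i\<in>I. c i ^ s i) \<in> power_ideal (sum s I)"
proof (induction I rule: finite_induct)
  case (insert i I)
  then show ?case
    using power_ideal_mult[OF power_ideal_power[of "c i" "s i"]] by simp
qed simp

section \<open>Closure properties of homogeneous polynomials\<close>

lemma homogeneous_zero: "0 \<in> homogeneous n k"
  by (simp add: homogeneous_def)

lemma homogeneous_add: "f \<in> homogeneous n k \<Longrightarrow> g \<in> homogeneous n k \<Longrightarrow> f + g \<in> homogeneous n k"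
  using keys_add[of f g] by (auto simp: homogeneous_def)

lemma homogeneous_sum: "(\<And>i. i \<in> I \<Longrightarrow> f i \<in> homogeneous n k) \<Longrightarrow> sum f I \<in> homogeneous n k"
  by (induction I rule: infinite_finite_induct) (auto intro: homogeneous_zero homogeneous_add)

lemma exponents_add: "e \<in> exponents n k \<Longrightarrow> e' \<in> exponents n l \<Longrightarrow> e + e' \<in> exponents n (k + l)"
  using keys_add[of e e'] by (auto simp: exponents_def mdeg_add)

lemma homogeneous_mult: "f \<in> homogeneous n k \<Longrightarrow> g \<in> homogeneous n l \<Longrightarrow> f * g \<in> homogeneous n (k + l)"
  using keys_mult[of f g] exponents_add[of _ n k _ l] by (fastforce simp: homogeneous_def)

lemma homogeneous_Const [simp]: "Const c \<in> homogeneous n 0"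
  by (simp add: homogeneous_def Const_def exponents_def mdeg_def)

lemma homogeneous_Const_mult: "f \<in> homogeneous n k \<Longrightarrow> Const c * f \<in> homogeneous n k"
  using homogeneous_mult[OF homogeneous_Const, of f n k] by simp

lemma homogeneous_prod:
  "finite I \<Longrightarrow> (\<And>i. i \<in> I \<Longrightarrow> f i \<in> homogeneous n (k i)) \<Longrightarrow> prod f I \<in> homogeneous n (sum k I)"
proof (induction I rule: finite_induct)
  case empty
  show ?case using homogeneous_Const[of 1 n] by simp
qed (auto intro: homogeneous_mult)

lemma homogeneous_Var: "i \<le> n \<Longrightarrow> Var i \<in> homogeneous n 1"
  by (simp add: homogeneous_def Var_def exponents_def mdeg_def)

lemma homogeneous_power: "f \<in> homogeneous n k \<Longrightarrow> f ^ l \<in> homogeneous n (l * k)"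
  using homogeneous_prod[of "{..<l}" "\<lambda>_. f" n "\<lambda>_. k"] by simp

text \<open>Each term of the Leibniz formula takes exactly one entry from every row, so the row
  degrees add up, even when they differ from row to row.\<close>

lemma homogeneous_det:
  fixes B :: "(nat, 'a::comm_ring_1) mpoly mat"
  assumes "B \<in> carrier_mat N N"
    and "\<And>i j. i < N \<Longrightarrow> j < N \<Longrightarrow> B $$ (i, j) \<in> homogeneous n (k i)"
  shows "det B \<in> homogeneous n (\<Sum>i<N. k i)"
proof -
  have "signof p * (\<Prod>i = 0..<N. B $$ (i, p i)) \<in> homogeneous n (\<Sum>i<N. k i)" if "p permutes {0..<N}" for p
  proof -
    have sign: "(signof p :: (nat, 'a) mpoly) = Const (signof p)"
      by (simp add: Const.hom_of_int)
    have "(\<Prod>i = 0..<N. B $$ (i, p i)) \<in> homogeneous n (\<Sum>i = 0..<N. k i)"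
      using permutes_in_image[OF that] by (intro homogeneous_prod assms) auto
    then show ?thesis
      unfolding lessThan_atLeast0 sign by (rule homogeneous_Const_mult)
  qed
  then show ?thesis
    unfolding det_def'[OF assms(1)] by (intro homogeneous_sum) auto
qed

section \<open>Exponent vectors of fixed degree and their number\<close>

lemma exponents_sum: "e \<in> exponents n k \<Longrightarrow> (\<Sum>j=0..n. Poly_Mapping.lookup e j) = k"
  using mdeg_superset[of "{0..n}" e] by (auto simp: exponents_def)

text \<open>Passes from functions to finitely supported maps: used to count exponents and to locate
  the derivative row of a given order in \<open>ts\<close>.\<close>

lemma exponents_exists:
  assumes "(\<Sum>j=0..n. s j) = k"
  obtains e where "e \<in> exponents n k" "\<And>j. j \<le> n \<Longrightarrow> Poly_Mapping.lookup e j = s j"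
proof -
  define e where "e = (\<Sum>j=0..n. Poly_Mapping.single j (s j))"
  have lookup: "Poly_Mapping.lookup e j = (if j \<le> n then s j else 0)" for j
    by (auto simp: e_def lookup_sum lookup_single when_def)
  have keys: "Poly_Mapping.keys e \<subseteq> {0..n}"
    by (auto simp: in_keys_iff lookup split: if_splits)
  have "mdeg e = k"
    using assms by (simp add: mdeg_superset[OF _ keys] lookup)
  with keys show thesis
    by (intro that[of e]) (auto simp: exponents_def lookup)
qed

text \<open>Stars and bars: reading off the coordinates \<open>0\<close> to \<open>n\<close>
  identifies exponents with lists of \<open>n + 1\<close> naturals of sum \<open>k\<close>.\<close>

lemma card_exponents: "card (exponents n k) = (k + n) choose n"
proof -
  let ?L = "{l::nat list. size l = n + 1 \<and> sum_list l = k}"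
  let ?f = "\<lambda>e. map (Poly_Mapping.lookup e) [0..<n + 1]"
  have sum_f: "sum_list (?f e) = (\<Sum>j=0..n. Poly_Mapping.lookup e j)" for e
    by (simp add: sum_list_distinct_conv_sum_set atLeastLessThanSuc_atLeastAtMost del: upt_Suc)
  have "bij_betw ?f (exponents n k) ?L"
  proof (rule bij_betwI')
    fix e e' assume e: "e \<in> exponents n k" "e' \<in> exponents n k"
    have "e = e'" if eq: "?f e = ?f e'"
    proof (rule poly_mapping_eqI)
      fix j
      show "Poly_Mapping.lookup e j = Poly_Mapping.lookup e' j"
      proof (cases "j \<le> n")
        case False
        then have "j \<notin> Poly_Mapping.keys e" "j \<notin> Poly_Mapping.keys e'"
          using e by (auto simp: exponents_def)
        then show ?thesis by (simp add: in_keys_iff)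
      qed (use eq in \<open>simp del: upt_Suc\<close>)
    qed
    then show "(?f e = ?f e') = (e = e')" by auto
  next
    fix e assume "e \<in> exponents n k"
    then show "?f e \<in> ?L"
      using sum_f[of e] by (simp add: exponents_sum del: upt_Suc)
  next
    fix l assume l: "l \<in> ?L"
    have "sum_list l = (\<Sum>j=0..n. l ! j)"
      using l by (simp add: sum_list_sum_nth atLeastLessThanSuc_atLeastAtMost)
    then have "(\<Sum>j=0..n. l ! j) = k" using l by simp
    then obtain e where "e \<in> exponents n k" "\<And>j. j \<le> n \<Longrightarrow> Poly_Mapping.lookup e j = l ! j"
      by (rule exponents_exists) blast
    then show "\<exists>e\<in>exponents n k. l = ?f e"
      using l by (intro bexI[of _ e] nth_equalityI) (auto simp del: upt_Suc)
  qed
  then have "card (exponents n k) = card ?L" by (rule bij_betw_same_card)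
  also have "\<dots> = (k + n) choose k" by (simp add: card_length_sum_list)
  also have "\<dots> = (k + n) choose n" by (simp add: binomial_symmetric[of k])
  finally show ?thesis .
qed

text \<open>Multiplicity is tested at every representative of a point, while the matrix contains one
  chosen representative; the scalar \<open>c\<close> relates the two.\<close>

lemma proj_space_proportional:
  assumes "P \<in> proj_space n" "p \<in> P" "q \<in> P"
  obtains c where "p \<in> carrier_vec (n + 1)" "q = c \<cdot>\<^sub>v p"
proof -
  from assms obtain u a b where u: "u \<in> carrier_vec (n + 1)"
    and "p = a \<cdot>\<^sub>v u" "q = b \<cdot>\<^sub>v u" "a \<noteq> 0" "b \<noteq> 0"
    unfolding proj_space_def Let_def by (auto elim!: quotientE)
  then show thesis
    by (intro that[of "b / a"]) (auto simp: smult_smult_assoc)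
qed

section \<open>Taylor coefficients of monomials\<close>

text \<open>The divided derivative of order \<open>s\<close> of the monomial with exponent \<open>e\<close> at \<open>a\<close>. Where the
  subtraction truncates, the binomial coefficient is \<open>0\<close>.\<close>

definition divided_derivative ::
  "nat \<Rightarrow> (nat \<Rightarrow> 'b::comm_ring_1) \<Rightarrow> (nat \<Rightarrow> nat) \<Rightarrow> (nat \<Rightarrow> nat) \<Rightarrow> 'b" where
  "divided_derivative n a s e = (\<Prod>j=0..n. of_nat (e j choose s j) * a j ^ (e j - s j))"

text \<open>In coordinate \<open>j\<close> this is
  \<open>(s + 1) * (e choose (s + 1)) = (e - s) * (e choose s)\<close>. The difference is formed in
  the ring, so the identity survives when \<open>s j\<close> exceeds \<open>e j\<close>.\<close>

lemma divided_derivative_Suc: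
  assumes "j \<le> n"
  shows "a j * of_nat (Suc (s j)) * divided_derivative n a (s(j := Suc (s j))) e
    = (of_nat (e j) - of_nat (s j)) * divided_derivative n a s e"
proof -
  have binom: "a j * of_nat (Suc (s j)) * (of_nat (e j choose Suc (s j)) * a j ^ (e j - Suc (s j)))
    = (of_nat (e j) - of_nat (s j)) * (of_nat (e j choose s j) * a j ^ (e j - s j))"
  proof (cases "s j < e j")
    case True
    obtain b where b: "e j = Suc (s j + b)"
      using less_imp_Suc_add[OF True] by blast
    have "of_nat (Suc (s j)) * of_nat (e j choose Suc (s j)) = (of_nat (Suc b) * of_nat (e j choose s j) :: 'a)"
      unfolding b of_nat_mult[symmetric] Suc_times_binomial_add ..
    moreover have "a j * of_nat (Suc (s j)) * (of_nat (e j choose Suc (s j)) * a j ^ b)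
      = of_nat (Suc (s j)) * of_nat (e j choose Suc (s j)) * (a j * a j ^ b)"
      by (simp only: mult.assoc mult.left_commute)
    ultimately have "a j * of_nat (Suc (s j)) * (of_nat (e j choose Suc (s j)) * a j ^ b)
      = of_nat (Suc b) * (of_nat (e j choose s j) * (a j * a j ^ b))"
      by (simp only: mult.assoc)
    then show ?thesis by (simp add: b Suc_diff_le)
  next
    \<comment> \<open>For \<open>s j = e j\<close> the ring factor on the right vanishes; beyond
      that both binomial coefficients do.\<close>
    case False
    then show ?thesis by (cases "s j = e j") (auto simp: binomial_eq_0)
  qed
  define R where "R = (\<Prod>i\<in>{0..n} - {j}. of_nat (e i choose s i) * a i ^ (e i - s i))"
  have "divided_derivative n a (s(j := Suc (s j))) e
    = of_nat (e j choose Suc (s j)) * a j ^ (e j - Suc (s j)) * R"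
    unfolding divided_derivative_def R_def using assms by (subst prod.remove[of _ j]) auto
  moreover have "divided_derivative n a s e = of_nat (e j choose s j) * a j ^ (e j - s j) * R"
    unfolding divided_derivative_def R_def using assms by (subst prod.remove[of _ j]) auto
  ultimately show ?thesis
    using arg_cong[OF binom, of "\<lambda>x. x * R"] by (simp only: mult.assoc)
qed

text \<open>Euler's identity for a form of degree \<open>d\<close> minus the order of
  \<open>s\<close>: its partial derivative in direction \<open>j\<close> is \<open>Suc (s j)\<close>
  times the divided derivative of order \<open>s(j := Suc (s j))\<close>.\<close>

lemma euler_divided_derivative:
  assumes "(\<Sum>j=0..n. e j) = d"
  shows "(of_nat d - of_nat (\<Sum>j=0..n. s j)) * divided_derivative n a s e
    = (\<Sum>j=0..n. a j * of_nat (Suc (s j)) * divided_derivative n a (s(j := Suc (s j))) e)"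
proof -
  have "(\<Sum>j=0..n. a j * of_nat (Suc (s j)) * divided_derivative n a (s(j := Suc (s j))) e)
    = (\<Sum>j=0..n. (of_nat (e j) - of_nat (s j)) * divided_derivative n a s e)"
    by (intro sum.cong refl divided_derivative_Suc) auto
  then show ?thesis
    by (simp add: sum_subtractf flip: sum_distrib_right assms)
qed

text \<open>Euler's identity writes a nonzero multiple of the sum of order \<open>s\<close> as a
  combination of sums whose order is one higher, so vanishing descends from order
  \<open>k\<close>.\<close>

lemma divided_derivative_lower_order_eq_0:
  fixes C :: "'i \<Rightarrow> 'b::{idom, ring_char_0}"
  assumes "\<And>i. i \<in> I \<Longrightarrow> (\<Sum>j=0..n. e i j) = d" and "k < d"
    and top: "\<And>s. (\<Sum>j=0..n. s j) = k \<Longrightarrow> (\<Sum>i\<in>I. C i * divided_derivative n a s (e i)) = 0"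
    and "(\<Sum>j=0..n. s j) \<le> k"
  shows "(\<Sum>i\<in>I. C i * divided_derivative n a s (e i)) = 0"
  using \<open>(\<Sum>j=0..n. s j) \<le> k\<close>
\<comment> \<open>The induction is on the distance of the order from \<open>k\<close>; the base case
  is order exactly \<open>k\<close>.\<close>
proof (induction "k - (\<Sum>j=0..n. s j)" arbitrary: s)
  case 0
  then show ?case by (intro top) simp
next
  case (Suc l)
  let ?D = "divided_derivative n a"
  have next_order: "(\<Sum>i\<in>I. C i * ?D (s(j := Suc (s j))) (e i)) = 0" if "j \<in> {0..n}" for j
  proof -
    have "(\<Sum>i=0..n. (s(j := Suc (s j))) i) = Suc (s j) + (\<Sum>i\<in>{0..n} - {j}. s i)"
      using that by (subst sum.remove[of _ j]) auto
    also have "\<dots> = Suc (\<Sum>i=0..n. s i)"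
      using that by (subst sum.remove[of "{0..n}" j]) auto
    finally show ?thesis using Suc.hyps(2) by (intro Suc.hyps(1)) linarith+
  qed
  have "(of_nat d - of_nat (\<Sum>j=0..n. s j)) * (\<Sum>i\<in>I. C i * ?D s (e i))
    = (\<Sum>i\<in>I. C i * ((of_nat d - of_nat (\<Sum>j=0..n. s j)) * ?D s (e i)))"
    by (simp only: sum_distrib_left mult.left_commute)
  also have "\<dots> = (\<Sum>i\<in>I. C i * (\<Sum>j=0..n. a j * of_nat (Suc (s j)) * ?D (s(j := Suc (s j))) (e i)))"
    by (intro sum.cong refl arg_cong2[where f = "(*)"] euler_divided_derivative assms(1))
  also have "\<dots> = (\<Sum>j=0..n. a j * of_nat (Suc (s j)) * (\<Sum>i\<in>I. C i * ?D (s(j := Suc (s j))) (e i)))"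
    unfolding sum_distrib_left by (subst sum.swap) (simp only: ac_simps)
  also have "\<dots> = 0" using next_order by (intro sum.neutral) simp
  finally have "(of_nat d - of_nat (\<Sum>j=0..n. s j)) * (\<Sum>i\<in>I. C i * ?D s (e i)) = 0" .
  \<comment> \<open>The order is at most \<open>k < d\<close>, so in characteristic 0 the Euler
    factor can be cancelled.\<close>
  moreover have "of_nat d \<noteq> (of_nat (\<Sum>j=0..n. s j) :: 'b)"
    using Suc.prems \<open>k < d\<close> by (simp only: of_nat_eq_iff)
  ultimately show ?case by (simp only: mult_eq_0_iff right_minus_eq) blast
qed

text \<open>The bound \<open>d\<close> replaces the individual exponents, making the index set the
  same for all monomials, so that this sum can be exchanged with a sum over monomials.\<close>

lemma taylor_monomial:
  assumes "\<And>j. j \<le> n \<Longrightarrow> e j \<le> d"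
  shows "(\<Prod>j=0..n. (a j + c j) ^ e j)
    = (\<Sum>s\<in>PiE {0..n} (\<lambda>_. {..d}). divided_derivative n a s e * (\<Prod>j=0..n. c j ^ s j))"
proof -
  have "(a j + c j) ^ e j = (\<Sum>k\<le>d. of_nat (e j choose k) * a j ^ (e j - k) * c j ^ k)"
    if "j \<in> {0..n}" for j
  proof -
    have "(a j + c j) ^ e j = (\<Sum>k\<le>e j. of_nat (e j choose k) * a j ^ (e j - k) * c j ^ k)"
      using binomial_ring[of "c j" "a j" "e j"] by (simp add: ac_simps)
    also have "\<dots> = (\<Sum>k\<le>d. of_nat (e j choose k) * a j ^ (e j - k) * c j ^ k)"
      using assms[of j] that by (intro sum.mono_neutral_left) (auto simp: binomial_eq_0)
    finally show ?thesis .
  qed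
  then show ?thesis
    by (simp add: prod_sum_PiE divided_derivative_def prod.distrib)
qed

text \<open>After exchanging sums, the coefficient of each product of powers of the
  \<open>c j\<close> is a weighted sum of divided derivatives. It is 0 below order \<open>m\<close>;
  from order \<open>m\<close> on, the product itself lies in the ideal power.\<close>

lemma taylor_in_power_ideal:
  fixes C :: "'i \<Rightarrow> (nat, 'a::field_char_0) mpoly"
  assumes deg: "\<And>i. i \<in> I \<Longrightarrow> (\<Sum>j=0..n. e i j) = d" and "0 < m" "m \<le> d"
    and top: "\<And>s. (\<Sum>j=0..n. s j) = m - 1 \<Longrightarrow> (\<Sum>i\<in>I. C i * divided_derivative n a s (e i)) = 0"
    and c: "\<And>j. j \<le> n \<Longrightarrow> c j \<in> power_ideal 1"
  shows "(\<Sum>i\<in>I. C i * (\<Prod>j=0..n. (a j + c j) ^ e i j)) \<in> power_ideal m"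
proof -
  let ?D = "divided_derivative n a"
  have "e i j \<le> d" if "i \<in> I" "j \<le> n" for i j
    using member_le_sum[of j "{0..n}" "e i"] deg that by auto
  then have "(\<Sum>i\<in>I. C i * (\<Prod>j=0..n. (a j + c j) ^ e i j))
    = (\<Sum>i\<in>I. C i * (\<Sum>s\<in>PiE {0..n} (\<lambda>_. {..d}). ?D s (e i) * (\<Prod>j=0..n. c j ^ s j)))"
    by (intro sum.cong refl arg_cong2[where f = "(*)"] taylor_monomial)
  also have "\<dots> = (\<Sum>s\<in>PiE {0..n} (\<lambda>_. {..d}). (\<Sum>i\<in>I. C i * ?D s (e i)) * (\<Prod>j=0..n. c j ^ s j))"
    unfolding sum_distrib_left sum_distrib_right by (subst sum.swap) (simp only: ac_simps)
  also have "\<dots> \<in> power_ideal m"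
  proof (rule power_ideal_sum)
    fix s
    show "(\<Sum>i\<in>I. C i * ?D s (e i)) * (\<Prod>j=0..n. c j ^ s j) \<in> power_ideal m"
    proof (cases "(\<Sum>j=0..n. s j) \<le> m - 1")
      case True
      then have "(\<Sum>i\<in>I. C i * ?D s (e i)) = 0"
        using \<open>0 < m\<close> \<open>m \<le> d\<close> by (intro divided_derivative_lower_order_eq_0[OF deg _ top]) simp_all
      then show ?thesis by (simp add: power_ideal_zero)
    next
      case False
      then have "m \<le> (\<Sum>j=0..n. s j)" by linarith
      moreover have "(\<Prod>j=0..n. c j ^ s j) \<in> power_ideal (\<Sum>j=0..n. s j)"
        using c by (intro power_ideal_prod_power) auto
      ultimately show ?thesis by (intro power_ideal_mult_left) (rule power_ideal_mono)
    qed
  qed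
  finally show ?thesis .
qed

section \<open>Entries of the interpolation matrix\<close>

text \<open>Built from a plain function, so that differentiation acts by function update.\<close>

definition a_exponent :: "nat \<Rightarrow> (nat \<Rightarrow> nat) \<Rightarrow> (ivar \<Rightarrow>\<^sub>0 nat)" where
  "a_exponent n e = (\<Sum>i=0..n. Poly_Mapping.single (A i) (e i))"

lemma lookup_a_exponent:
  "Poly_Mapping.lookup (a_exponent n e) v = (case v of A i \<Rightarrow> if i \<le> n then e i else 0 | X i \<Rightarrow> 0)"
  by (auto simp: a_exponent_def lookup_sum lookup_single when_def split: ivar.split)

lemma single_a_exponent:
  "Poly_Mapping.single (a_exponent n e) c = Const c * (\<Prod>i=0..n. Var (A i) ^ e i)"
proof -
  have single_power: "Var v ^ k = Poly_Mapping.single (Poly_Mapping.single v k) 1" for v :: ivar and k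
  proof (induction k)
    case (Suc k)
    then show ?case by (simp add: Var_def mult_single flip: single_add)
  qed simp
  have "(\<Prod>i\<in>I. Poly_Mapping.single (Poly_Mapping.single (A i) (e i)) 1)
    = (Poly_Mapping.single (\<Sum>i\<in>I. Poly_Mapping.single (A i) (e i)) 1 :: (ivar, 'a) mpoly)" for I
    by (induction I rule: infinite_finite_induct) (simp_all add: mult_single)
  then show ?thesis
    by (simp add: a_exponent_def single_power Const_def mult_single)
qed

section \<open>Iterated partial derivatives of monomials\<close>

lemma pderivative_single:
  "pderivative v (Poly_Mapping.single e c)
    = Poly_Mapping.single (e - Poly_Mapping.single v 1) (of_nat (Poly_Mapping.lookup e v) * c)"
  by (simp add: pderivative_def)

lemma pderivative_a_exponent:
  assumes "j \<le> n"
  shows "pderivative (A j) (Poly_Mapping.single (a_exponent n e) c)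
    = Poly_Mapping.single (a_exponent n (e(j := e j - 1))) (of_nat (e j) * c)"
proof -
  have "a_exponent n e - Poly_Mapping.single (A j) 1 = a_exponent n (e(j := e j - 1))"
    by (rule poly_mapping_eqI)
      (auto simp: lookup_minus lookup_a_exponent lookup_single when_def assms split: ivar.split)
  then show ?thesis by (simp add: pderivative_single lookup_a_exponent assms)
qed

text \<open>The falling factorial is written as \<open>fact k\<close> times a binomial coefficient,
  which later exposes the divided derivative.\<close>

lemma pderivative_funpow_a_exponent:
  assumes "j \<le> n"
  shows "(pderivative (A j) ^^ k) (Poly_Mapping.single (a_exponent n e) c)
    = Poly_Mapping.single (a_exponent n (e(j := e j - k))) (of_nat (fact k * (e j choose k)) * c)"
proof (induction k)
  case (Suc k)
  have "(e j - k) * (fact k * (e j choose k)) = fact (Suc k) * (e j choose Suc k)"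
  proof (cases "k < e j")
    case True
    then obtain b where b: "e j = Suc (k + b)" by (blast dest: less_imp_Suc_add)
    then have diff: "e j - k = Suc b" by simp
    have "fact (Suc k) * (e j choose Suc k) = fact k * (Suc k * (e j choose Suc k))"
      by (simp only: fact_Suc of_nat_id ac_simps)
    also have "\<dots> = (e j - k) * (fact k * (e j choose k))"
      unfolding diff unfolding b Suc_times_binomial_add by (simp only: ac_simps)
    finally show ?thesis ..
  qed (simp add: binomial_eq_0)
  then have "of_nat (e j - k) * (of_nat (fact k * (e j choose k)) * c)
    = of_nat (fact (Suc k) * (e j choose Suc k)) * c"
    by (metis mult.assoc of_nat_mult)
  with Suc show ?case
    by (simp add: pderivative_a_exponent[OF assms] fun_upd_def cong: if_cong del: of_nat_mult fact_Suc)
qed simp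

lemma a_derivative_monomial:
  "a_derivative n t (\<Prod>i=0..n. Var (A i) ^ e i)
    = Const (\<Prod>i=0..n. of_nat (fact (Poly_Mapping.lookup t i) * (e i choose Poly_Mapping.lookup t i)))
      * (\<Prod>i=0..n. Var (A i) ^ (e i - Poly_Mapping.lookup t i))"
proof -
  let ?t = "Poly_Mapping.lookup t"
  let ?b = "\<lambda>i. of_nat (fact (?t i) * (e i choose ?t i))"
  \<comment> \<open>Induction on the number \<open>N\<close> of variables already processed; the
    others keep their original exponents.\<close>
  have "fold (\<lambda>i. pderivative (A i) ^^ ?t i) [0..<N] (Poly_Mapping.single (a_exponent n e) 1)
    = Poly_Mapping.single (a_exponent n (\<lambda>i. if i < N then e i - ?t i else e i)) (\<Prod>i<N. ?b i)"
    if "N \<le> n + 1" for N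
    using that
  proof (induction N)
    case (Suc N)
    let ?e = "\<lambda>i. if i < N then e i - ?t i else e i"
    have "?e(N := ?e N - ?t N) = (\<lambda>i. if i < Suc N then e i - ?t i else e i)"
      by (auto simp: fun_eq_iff less_Suc_eq)
    then show ?case
      using Suc by (simp add: pderivative_funpow_a_exponent ac_simps del: of_nat_mult)
  qed simp
  from this[of "n + 1"] have "a_derivative n t (Poly_Mapping.single (a_exponent n e) 1)
    = Poly_Mapping.single (a_exponent n (\<lambda>i. if i < n + 1 then e i - ?t i else e i)) (\<Prod>i<n+1. ?b i)"
    unfolding a_derivative_def by simp
  also have "\<dots> = Const (\<Prod>i<n+1. ?b i) * (\<Prod>i=0..n. Var (A i) ^ (if i < n + 1 then e i - ?t i else e i))"
    by (rule single_a_exponent)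
  also have "(\<Prod>i=0..n. Var (A i) ^ (if i < n + 1 then e i - ?t i else e i))
    = (\<Prod>i=0..n. Var (A i) ^ (e i - ?t i) :: (ivar, 'a) mpoly)"
    by (intro prod.cong) auto
  also have "{..<n + 1} = {0..n}" by auto
  finally show ?thesis by (simp add: single_a_exponent)
qed

lemma monomial_row_index:
  "j < length es \<Longrightarrow> monomial_row n es q $ j = (\<Prod>i=0..n. q i ^ Poly_Mapping.lookup (es ! j) i)"
  by (simp add: monomial_row_def vec_of_list_index)

lemma dim_monomial_row [simp]: "dim_vec (monomial_row n es q) = length es"
  by (simp add: monomial_row_def)

lemma interpolation_matrix_dim [simp]:
  "dim_row (interpolation_matrix n es ts ps) = length ts + length ps + 1"
  "dim_col (interpolation_matrix n es ts ps) = length es"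
  by (simp_all add: interpolation_matrix_def)

interpretation at_x: comm_ring_hom "at_x y"
  unfolding at_x_def by (rule subst_hom)

lemma at_x_Const [simp]: "at_x y (Const c) = Const c"
  by (simp add: at_x_def)

lemma at_x_Var [simp]: "at_x y (Var (A i)) = Var i" "at_x y (Var (X i)) = Const (y $ i)"
  by (simp_all add: at_x_def)

lemma interpolation_matrix_derivative_row:
  assumes "i < length ts" "j < length es"
  shows "at_x y (interpolation_matrix n es ts ps $$ (i, j))
    = Const (\<Prod>l=0..n. of_nat (fact (Poly_Mapping.lookup (ts ! i) l)
          * (Poly_Mapping.lookup (es ! j) l choose Poly_Mapping.lookup (ts ! i) l)))
      * (\<Prod>l=0..n. Var l ^ (Poly_Mapping.lookup (es ! j) l - Poly_Mapping.lookup (ts ! i) l))"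
  using assms by (simp add: interpolation_matrix_def mat_of_rows_index nth_append monomial_row_index
      a_derivative_monomial at_x.hom_mult at_x.hom_prod at_x.hom_power del: of_nat_mult)

lemma interpolation_matrix_point_row:
  assumes "k < length ps" "j < length es"
  shows "at_x y (interpolation_matrix n es ts ps $$ (length ts + k, j))
    = Const (\<Prod>l=0..n. (ps ! k) $ l ^ Poly_Mapping.lookup (es ! j) l)"
  using assms by (simp add: interpolation_matrix_def mat_of_rows_index nth_append monomial_row_index
      at_x.hom_prod at_x.hom_power Const.hom_prod Const.hom_power)

lemma interpolation_matrix_last_row:
  assumes "j < length es"
  shows "at_x y (interpolation_matrix n es ts ps $$ (length ts + length ps, j))
    = Const (\<Prod>l=0..n. y $ l ^ Poly_Mapping.lookup (es ! j) l)"
  using assms by (simp add: interpolation_matrix_def mat_of_rows_index nth_append monomial_row_index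
      at_x.hom_prod at_x.hom_power Const.hom_prod Const.hom_power)

lemma homogeneous_derivative_entry:
  assumes e: "e \<in> exponents n d" and t: "t \<in> exponents n k"
  shows "Const (\<Prod>l=0..n. of_nat (fact (Poly_Mapping.lookup t l)
          * (Poly_Mapping.lookup e l choose Poly_Mapping.lookup t l)))
      * (\<Prod>l=0..n. Var l ^ (Poly_Mapping.lookup e l - Poly_Mapping.lookup t l))
    \<in> homogeneous n (d - k)"
proof (cases "\<exists>l\<in>{0..n}. Poly_Mapping.lookup e l < Poly_Mapping.lookup t l")
  \<comment> \<open>Some subtraction may truncate here, but a binomial coefficient is then 0 and the
    whole entry vanishes.\<close>
  case True
  then have "(\<Prod>l=0..n. of_nat (fact (Poly_Mapping.lookup t l)
          * (Poly_Mapping.lookup e l choose Poly_Mapping.lookup t l))) = (0 :: 'a)"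
    by (intro prod_zero) (force simp: binomial_eq_0)+
  then show ?thesis by (simp add: homogeneous_zero del: of_nat_mult)
next
  case False
  then have "(\<Sum>l=0..n. Poly_Mapping.lookup e l - Poly_Mapping.lookup t l) = d - k"
    using exponents_sum[OF e] exponents_sum[OF t] by (subst sum_subtractf_nat) (auto simp: not_less)
  moreover have "(\<Prod>l=0..n. Var l ^ (Poly_Mapping.lookup e l - Poly_Mapping.lookup t l))
    \<in> homogeneous n (\<Sum>l=0..n. (Poly_Mapping.lookup e l - Poly_Mapping.lookup t l) * 1)"
    by (intro homogeneous_prod homogeneous_power homogeneous_Var) auto
  ultimately show ?thesis by (intro homogeneous_Const_mult) simp
qed

section \<open>Degree and multiplicity of the determinant\<close>

text \<open>An off-diagonal entry of \<open>B * adj_mat B\<close>, which equals \<open>det B\<close>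
  times the identity matrix.\<close>

lemma cofactor_expansion_other_row:
  fixes B :: "'a::comm_ring_1 mat"
  assumes B: "B \<in> carrier_mat N N" and "i < N" "k < N" "i \<noteq> k"
  shows "(\<Sum>j<N. B $$ (i, j) * cofactor B k j) = 0"
proof -
  have "(B * adj_mat B) $$ (i, k) = (\<Sum>j<N. B $$ (i, j) * cofactor B k j)"
    using assms adj_mat(1)[OF B]
    by (auto simp: scalar_prod_def adj_mat_def lessThan_atLeast0 intro!: sum.cong)
  then show ?thesis using adj_mat(2)[OF B] assms by simp
qed

text \<open>Row \<open>k\<close> may be any row of point type after the derivative rows, so one
  statement covers the points of \<open>Z\<close> and \<open>S\<close>. Here \<open>q\<close> holds
  the coordinates used in the matrix and \<open>p\<close> those used for the chart.\<close>

lemma multiplicity_det: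
  fixes B :: "(nat, 'a::field_char_0) mpoly mat"
  assumes B: "B \<in> carrier_mat N N" and N: "N = length es"
    and es: "set es \<subseteq> exponents n d"
    and ts: "exponents n (m - 1) \<subseteq> set ts" and "0 < m" "m \<le> d"
    and derivative_row: "\<And>i j. i < length ts \<Longrightarrow> j < N \<Longrightarrow> B $$ (i, j)
      = Const (\<Prod>l=0..n. of_nat (fact (Poly_Mapping.lookup (ts ! i) l)
          * (Poly_Mapping.lookup (es ! j) l choose Poly_Mapping.lookup (ts ! i) l)))
      * (\<Prod>l=0..n. Var l ^ (Poly_Mapping.lookup (es ! j) l - Poly_Mapping.lookup (ts ! i) l))"
    and k: "length ts \<le> k" "k < N"
    and point_row: "\<And>j. j < N \<Longrightarrow> B $$ (k, j) = Const (\<Prod>l=0..n. q $ l ^ Poly_Mapping.lookup (es ! j) l)"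
    and i: "i \<le> n" "p $ i \<noteq> 0" and q: "\<And>l. l \<le> n \<Longrightarrow> q $ l = c * p $ l"
  shows "local_equation i p (det B) \<in> power_ideal m"
proof -
  \<comment> \<open>\<open>a\<close> is the substitution of \<open>local_equation\<close>. Adding
    \<open>b\<close>, which vanishes at the origin, turns it into the fixed point with coordinates
    \<open>p $ j / p $ i\<close>.\<close>
  define a where "a = (\<lambda>j. if j = i then 1 else Var j + Const (p $ j / p $ i) :: (nat, 'a) mpoly)"
  define b where "b = (\<lambda>j. if j = i then 0 else - Var j :: (nat, 'a) mpoly)"
  define e where "e = (\<lambda>j. Poly_Mapping.lookup (es ! j))"
  interpret h: comm_ring_hom "subst a" by (rule subst_hom)
  define B' where "B' = map_mat (subst a) B"
  have B': "B' \<in> carrier_mat N N" using B by (simp add: B'_def)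
  have "local_equation i p (det B) = det B'"
    by (simp add: local_equation_def B'_def flip: a_def)
  also have "\<dots> = (\<Sum>j<N. B' $$ (k, j) * cofactor B' k j)"
    using laplace_expansion_row[OF B' k(2)] .
  \<comment> \<open>The point \<open>q\<close> is \<open>c * p $ i\<close> times the normalised
    point, and the monomials have degree \<open>d\<close>; the resulting common scalar is absorbed
    into the cofactor weights.\<close>
  also have "\<dots> = (\<Sum>j<N. (Const ((c * p $ i) ^ d) * cofactor B' k j) * (\<Prod>l=0..n. (a l + b l) ^ e j l))"
  proof (intro sum.cong refl)
    fix j assume j: "j \<in> {..<N}"
    have ab: "a l + b l = Const (p $ l / p $ i)" for l
      using i by (auto simp: a_def b_def)
    have "(\<Sum>l=0..n. e j l) = d"
      using es j N nth_mem[of j es] by (auto simp: e_def intro!: exponents_sum)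
    then have "(c * p $ i) ^ d * (\<Prod>l=0..n. (p $ l / p $ i) ^ e j l)
      = (\<Prod>l=0..n. (c * p $ i) ^ e j l * (p $ l / p $ i) ^ e j l)"
      by (simp add: prod.distrib flip: power_sum)
    also have "\<dots> = (\<Prod>l=0..n. q $ l ^ e j l)"
      using i q by (intro prod.cong) (auto simp flip: power_mult_distrib)
    finally have "B' $$ (k, j) = Const ((c * p $ i) ^ d) * (\<Prod>l=0..n. (a l + b l) ^ e j l)"
      using B j k point_row[of j]
      by (simp add: B'_def ab e_def flip: Const.hom_mult Const.hom_power Const.hom_prod)
    then show "B' $$ (k, j) * cofactor B' k j
      = (Const ((c * p $ i) ^ d) * cofactor B' k j) * (\<Prod>l=0..n. (a l + b l) ^ e j l)"
      by (simp only: ac_simps)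
  qed
  also have "\<dots> \<in> power_ideal m"
  proof (rule taylor_in_power_ideal[OF _ \<open>0 < m\<close> \<open>m \<le> d\<close>])
    show "(\<Sum>l=0..n. e j l) = d" if "j \<in> {..<N}" for j
      using es that N nth_mem[of j es] by (auto simp: e_def intro!: exponents_sum)
  next
    fix l assume "l \<le> n"
    show "b l \<in> power_ideal 1"
      by (auto simp: b_def power_ideal_def in_keys_iff Var_def lookup_single when_def mdeg_def)
  next
    fix s assume "(\<Sum>j=0..n. s j) = m - 1"
    then obtain t where "t \<in> exponents n (m - 1)" and t: "\<And>l. l \<le> n \<Longrightarrow> Poly_Mapping.lookup t l = s l"
      by (rule exponents_exists) blast
    then obtain r where r: "r < length ts" "t = ts ! r"
      using ts by (metis in_set_conv_nth subsetD)
    \<comment> \<open>Ordinary derivatives differ from divided ones by this product of factorials,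
      which is nonzero in characteristic 0.\<close>
    define f where "f = (\<Prod>l=0..n. of_nat (fact (s l)) :: (nat, 'a) mpoly)"
    have "f \<noteq> 0" by (simp add: f_def)
    have entry: "B' $$ (r, j) = f * divided_derivative n a s (e j)" if "j < N" for j
    proof -
      have "B' $$ (r, j) = subst a (Const (\<Prod>l=0..n. of_nat (fact (s l) * (e j l choose s l)))
          * (\<Prod>l=0..n. Var l ^ (e j l - s l)))"
        using B k r that t by (simp add: B'_def derivative_row e_def del: of_nat_mult)
      also have "\<dots> = f * divided_derivative n a s (e j)"
        by (simp only: h.hom_mult h.hom_prod h.hom_power h.hom_of_nat subst_Var Const.hom_prod
            Const.hom_of_nat Const.hom_mult of_nat_mult f_def divided_derivative_def prod.distrib mult.assoc)
      finally show ?thesis .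
    qed
    \<comment> \<open>Derivative row \<open>r\<close> is paired with the cofactors of row
      \<open>k\<close>; the rows differ because \<open>r < length ts\<close> and
      \<open>length ts \<le> k\<close>.\<close>
    have "f * (\<Sum>j<N. cofactor B' k j * divided_derivative n a s (e j)) = (\<Sum>j<N. B' $$ (r, j) * cofactor B' k j)"
      by (simp add: entry sum_distrib_left ac_simps)
    also have "\<dots> = 0"
      using r k by (intro cofactor_expansion_other_row[OF B']) auto
    finally have "(\<Sum>j<N. cofactor B' k j * divided_derivative n a s (e j)) = 0"
      using \<open>f \<noteq> 0\<close> by simp
    then show "(\<Sum>j<N. (Const ((c * p $ i) ^ d) * cofactor B' k j) * divided_derivative n a s (e j)) = 0"
      by (simp add: mult.assoc flip: sum_distrib_left)
  qed
  finally show ?thesis .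
qed

theorem theorem7:
  fixes Z :: "'a::field_char_0 vec set set" and S :: "'a vec set"
    and n d m r :: nat
    and es ts :: "(nat \<Rightarrow>\<^sub>0 nat) list"
    and Ps :: "'a vec set list" and ps :: "'a vec list" and y :: "'a vec"
    and F :: "(ivar, 'a) mpoly"
  assumes "Z \<subseteq> proj_space n" and "set Ps = Z" and "distinct Ps" and "length Ps = r"
    and "d > 0" and "m > 0"
    and "(d + n) choose n = ((m + n - 1) choose n) + r + 1"
    and "list_all2 (\<in>) ps Ps"
    and "distinct es" and "set es = exponents n d"
    and "distinct ts" and "set ts = exponents n (m - 1)"
    and "F = det (interpolation_matrix n es ts ps)"
    and "S \<in> proj_space n" and "y \<in> S"
    and "at_x y F \<noteq> 0"
  shows "defines_hypersurface n (((m + n - 1) choose n) * (d - m + 1)) (at_x y F)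
    \<and> vanishes_with_multiplicity n m (at_x y F) S
    \<and> (\<forall>P\<in>Z. vanishes_with_multiplicity n m (at_x y F) P)"
proof -
  define M where "M = interpolation_matrix n es ts ps"
  define N where "N = length es"
  define B where "B = map_mat (at_x y) M"
  \<comment> \<open>\<open>det\<close> is 0 by convention on non-square matrices, so nonvanishing
    yields that \<open>M\<close> is square.\<close>
  have "det M \<noteq> 0"
    using \<open>at_x y F \<noteq> 0\<close> by (auto simp: M_def \<open>F = _\<close>)
  then have "dim_row M = dim_col M" by (auto simp: det_def split: if_splits)
  then have N: "N = length ts + length ps + 1" by (simp add: M_def N_def)
  have B: "B \<in> carrier_mat N N"
    using N by (intro carrier_matI) (simp_all add: B_def M_def N_def)
  have det_B: "at_x y F = det B" by (simp add: B_def M_def \<open>F = _\<close>)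
  have B_index: "B $$ (i, j) = at_x y (M $$ (i, j))" if "i < N" "j < N" for i j
    using that N by (simp add: B_def M_def N_def)
  have card_ts: "length ts = (m + n - 1) choose n"
    using distinct_card[OF \<open>distinct ts\<close>] \<open>m > 0\<close> by (simp add: \<open>set ts = _\<close> card_exponents)
  \<comment> \<open>Otherwise monotonicity of binomial coefficients would contradict the dimension
    count.\<close>
  have "m \<le> d"
  proof (rule ccontr)
    assume "\<not> m \<le> d"
    then have "(d + n) choose n \<le> (m + n - 1) choose n"
      by (intro binomial_right_mono) simp
    then show False using assms(7) by simp
  qed
  have derivative_row: "B $$ (i, j)
      = Const (\<Prod>l=0..n. of_nat (fact (Poly_Mapping.lookup (ts ! i) l)
          * (Poly_Mapping.lookup (es ! j) l choose Poly_Mapping.lookup (ts ! i) l)))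
      * (\<Prod>l=0..n. Var l ^ (Poly_Mapping.lookup (es ! j) l - Poly_Mapping.lookup (ts ! i) l))"
    if "i < length ts" "j < N" for i j
    using that N unfolding N_def
    by (subst B_index) (simp_all only: N_def M_def interpolation_matrix_derivative_row)
  \<comment> \<open>Once \<open>y\<close> is substituted, the last row has the same shape as the
    point rows, so \<open>S\<close> is treated as one more point.\<close>
  define Qs where "Qs = ps @ [y]"
  have point_row: "B $$ (length ts + k, j) = Const (\<Prod>l=0..n. Qs ! k $ l ^ Poly_Mapping.lookup (es ! j) l)"
    if "k < length Qs" "j < N" for k j
  proof (cases "k < length ps")
    case True
    then show ?thesis
      using that N by (simp add: B_index Qs_def nth_append M_def N_def interpolation_matrix_point_row)
  next
    case False
    then have "k = length ps" using that by (simp add: Qs_def)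
    then show ?thesis
      using that N by (simp add: B_index Qs_def M_def N_def interpolation_matrix_last_row)
  qed
  have "det B \<in> homogeneous n (\<Sum>i<N. if i < length ts then d - m + 1 else 0)"
  proof (rule homogeneous_det[OF B])
    fix i j assume ij: "i < N" "j < N"
    show "B $$ (i, j) \<in> homogeneous n (if i < length ts then d - m + 1 else 0)"
    proof (cases "i < length ts")
      case True
      have "es ! j \<in> exponents n d" "ts ! i \<in> exponents n (m - 1)"
        using ij True nth_mem[of j es] nth_mem[of i ts] \<open>set es = _\<close> \<open>set ts = _\<close>
        by (simp_all add: N_def)
      then have "B $$ (i, j) \<in> homogeneous n (d - (m - 1))"
        unfolding derivative_row[OF True ij(2)] by (rule homogeneous_derivative_entry)
      \<comment> \<open>\<open>m \<le> d\<close> and \<open>m > 0\<close> make the truncated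
        differences \<open>d - (m - 1)\<close> and \<open>d - m + 1\<close> agree.\<close>
      with True show ?thesis using \<open>m > 0\<close> \<open>m \<le> d\<close> by (simp add: Suc_diff_le)
    next
      case False
      then show ?thesis
        using ij N point_row[of "i - length ts" j] by (simp add: Qs_def)
    qed
  qed
  also have "(\<Sum>i<N. if i < length ts then d - m + 1 else 0) = length ts * (d - m + 1)"
  proof -
    have "{..<N} \<inter> {i. i < length ts} = {..<length ts}" using N by auto
    then show ?thesis by (simp add: sum.If_cases)
  qed
  \<comment> \<open>A hypersurface must have positive degree, so there has to be at least one
    derivative row.\<close>
  moreover have "0 < (m + n - 1) choose n"
    using \<open>m > 0\<close> by (intro zero_less_binomial) simp
  ultimately have "defines_hypersurface n (((m + n - 1) choose n) * (d - m + 1)) (at_x y F)"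
    using \<open>at_x y F \<noteq> 0\<close> by (simp add: defines_hypersurface_def homogeneous_def det_B card_ts)
  moreover have multiplicity: "vanishes_with_multiplicity n m (at_x y F) P"
    if P: "P \<in> proj_space n" and k: "k < length Qs" "Qs ! k \<in> P" for P k
    unfolding vanishes_with_multiplicity_def
  proof (intro ballI allI impI)
    fix p i e assume p: "p \<in> P" and i: "i \<le> n" "p $ i \<noteq> 0"
      and e: "e \<in> Poly_Mapping.keys (local_equation i p (at_x y F))"
    obtain c where "p \<in> carrier_vec (n + 1)" "Qs ! k = c \<cdot>\<^sub>v p"
      using proj_space_proportional[OF P p k(2)] .
    then have q: "Qs ! k $ l = c * p $ l" if "l \<le> n" for l using that by simp
    have "local_equation i p (det B) \<in> power_ideal m"
      by (rule multiplicity_det[OF B N_def _ _ \<open>m > 0\<close> \<open>m \<le> d\<close> derivative_row _ _ point_row[OF k(1)] i q])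
        (use k(1) N \<open>set es = _\<close> \<open>set ts = _\<close> in \<open>auto simp: Qs_def\<close>)
    then show "m \<le> mdeg e" using e by (simp add: power_ideal_def det_B)
  qed
  moreover have "vanishes_with_multiplicity n m (at_x y F) S"
    by (rule multiplicity[of _ "length ps"]) (use assms in \<open>auto simp: Qs_def\<close>)
  moreover have "vanishes_with_multiplicity n m (at_x y F) P" if "P \<in> Z" for P
  proof -
    obtain k where "k < length Ps" "Ps ! k = P"
      using \<open>P \<in> Z\<close> \<open>set Ps = Z\<close> by (auto simp: in_set_conv_nth)
    then have "k < length ps" "ps ! k \<in> P"
      using \<open>list_all2 (\<in>) ps Ps\<close> by (auto simp: list_all2_conv_all_nth)
    then show ?thesis
      using \<open>Z \<subseteq> proj_space n\<close> \<open>P \<in> Z\<close> by (intro multiplicity[of _ k]) (auto simp: Qs_def nth_append)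
  qed
  ultimately show ?thesis by blast
qed

end
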